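(* Let $r\in\{3,4\}$ and let $k\ge 0$ be an integer. For any connected $r$-uniform hypergraph $\mathcal{H}$ with $n$ vertices, where $k+r\le n$, and with no isolated vertices, $$\gamma_p^k(\mathcal{H}) \leq \frac{n}{r+k}.$$
   Context: A (finite) hypergraph $\mathcal{H}=(V,E)$ is a finite set of vertices $V$ together with a set of edges $E$ that is a subset of the power set of $V$. It is $r$-uniform if every edge has exactly $r$ vertices. Two distinct vertices are adjacent (neighbors) if some edge contains both. It is connected if any two vertices are joined by a path of consecutively adjacent vertices. For $v\in V$, the closed neighborhood $N[v]$ consists of $v$ and all vertices adjacent to $v$; for $S\subseteq V$, $N[S]=\bigcup_{v\in S}N[v]$. A set $D\subseteq V$ colors vertices blue by the following process (vertices that are not blue are white). (1) Domination step: all vertices in $N[D]$ are colored blue. (2) Forcing step, applied repeatedly: given a blue vertex $v$, if there is a set of at most $k$ edges, each incident with $v$, that together contain all of $v$'s white neighbors, then these white neighbors turn blue. If iteratively applying these rules makes all vertices blue, then $D$ is a $k$-power dominating set of $\mathcal{H}$. The $k$-power domination number $\gamma_p^k(\mathcal{H})$ is the minimum cardinality of a $k$-power dominating set of $\mathcal{H}$. *)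

theory Defs
  imports Complex_Main
begin

definition hypergraph :: "'a set \<Rightarrow> 'a set set \<Rightarrow> bool" where
  "hypergraph V E \<longleftrightarrow> finite V \<and> E \<subseteq> Pow V"

definition uniform :: "nat \<Rightarrow> 'a set set \<Rightarrow> bool" where
  "uniform r E \<longleftrightarrow> (\<forall>e\<in>E. card e = r)"

definition adjacent :: "'a set set \<Rightarrow> 'a \<Rightarrow> 'a \<Rightarrow> bool" where
  "adjacent E u v \<longleftrightarrow> u \<noteq> v \<and> (\<exists>e\<in>E. u \<in> e \<and> v \<in> e)"

definition hconnected :: "'a set \<Rightarrow> 'a set set \<Rightarrow> bool" where
  "hconnected V E \<longleftrightarrow> (\<forall>u\<in>V. \<forall>v\<in>V. (adjacent E)\<^sup>*\<^sup>* u v)"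

definition isolated :: "'a set set \<Rightarrow> 'a \<Rightarrow> bool" where
  "isolated E v \<longleftrightarrow> \<not> (\<exists>u. adjacent E v u)"

definition neighbors :: "'a set set \<Rightarrow> 'a \<Rightarrow> 'a set" where
  "neighbors E v = {u. adjacent E v u}"

definition closed_neighborhood :: "'a set set \<Rightarrow> 'a set \<Rightarrow> 'a set" where
  "closed_neighborhood E S = (\<Union>v\<in>S. insert v (neighbors E v))"

text \<open>One application of the forcing rule to the set \<open>B\<close> of blue vertices, by a
  single blue vertex \<open>v\<close>; its white neighbors are \<open>neighbors E v - B\<close>.
  The conjunct \<open>finite F\<close> is needed because infinite sets have cardinality 0.\<close>

definition forcing_step :: "'a set set \<Rightarrow> nat \<Rightarrow> 'a set \<Rightarrow> 'a set \<Rightarrow> bool" where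
  "forcing_step E k B B' \<longleftrightarrow>
    (\<exists>v\<in>B. (\<exists>F\<subseteq>E. finite F \<and> card F \<le> k \<and> (\<forall>e\<in>F. v \<in> e) \<and> neighbors E v - B \<subseteq> \<Union>F)
           \<and> B' = B \<union> (neighbors E v - B))"

text \<open>Forcing is monotone in the set of blue vertices, so the order of the forcing
  steps does not affect whether all vertices become blue.\<close>

definition power_dominating :: "'a set \<Rightarrow> 'a set set \<Rightarrow> nat \<Rightarrow> 'a set \<Rightarrow> bool" where
  "power_dominating V E k D \<longleftrightarrow>
    D \<subseteq> V \<and> (forcing_step E k)\<^sup>*\<^sup>* (closed_neighborhood E D) V"

text \<open>The minimum exists, as \<open>V\<close> itself is a \<open>k\<close>-power dominating set.\<close>

definition power_domination_number :: "'a set \<Rightarrow> 'a set set \<Rightarrow> nat \<Rightarrow> nat" where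
  "power_domination_number V E k = (LEAST m. \<exists>D. power_dominating V E k D \<and> card D = m)"

end

theory Submission
  imports Defs
begin

text \<open>
  Choose a minimum \<open>k\<close>-power dominating set \<open>D\<close> such that no private neighborhood of a vertex
  \<open>v\<close> of \<open>D\<close> can be covered by \<open>k\<close> edges at \<open>v\<close>. Then some edges meeting \<open>D\<close> have a union \<open>W\<close>
  that contains \<open>D\<close>, forces every vertex to become blue, and misses at least \<open>k |D|\<close> vertices.
  By the Chvatal-McDiarmid transversal bound \<open>W\<close> is dominated by at most \<open>|W| / r\<close> of its vertices,
  and these form a \<open>k\<close>-power dominating set, so \<open>r |D| \<le> |W| \<le> n - k |D|\<close>.
\<close>

subsection \<open>Transversals of 2- and 3-uniform hypergraphs\<close>

text \<open>Privacy alone guarantees only \<open>k + 1\<close> vertices for each member of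
  \<open>D\<close>, short of the required \<open>r + k\<close>. The rest comes from comparing
  \<open>D\<close> with a second power dominating set: by minimality \<open>D\<close> is no larger
  than a dominating set of \<open>W\<close>, and the \<open>k |D|\<close> vertices outside
  \<open>W\<close> come on top. The restriction on \<open>r\<close> stems from the transversal
  bound. A q-uniform hypergraph with n vertices and m edges has a transversal of size at most (n +
  m) / (q + 1) for q = 2 and q = 3, whereas from q = 4 on the bound (n + floor(q/2) m) / floor(3q/2)
  no longer gives vertices and edges equal weight. Equal weight is what domination needs: the edges
  shrink to size q = r - 1 by losing one private vertex each, and these lost vertices pay for the
  term m, so that n + m is at most \<open>|W|\<close>.\<close>

lemma minimal_subcover:
  assumes "finite F" "Z \<subseteq> \<Union>F"
  shows "\<exists>M\<subseteq>F. Z \<subseteq> \<Union>M \<and> (\<forall>e\<in>M. \<exists>z\<in>Z. z \<in> e \<and> (\<forall>e'\<in>M. z \<in> e' \<longrightarrow> e' = e))"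
proof -
  let ?P = "\<lambda>M. M \<subseteq> F \<and> Z \<subseteq> \<Union>M"
  have "?P F" using assms by simp
  from ex_has_least_nat[of ?P, OF this, of card] obtain M
    where M: "M \<subseteq> F" "Z \<subseteq> \<Union>M" and min: "\<And>N. ?P N \<Longrightarrow> card M \<le> card N"
    by auto
  \<comment> \<open>An edge all of whose points in \<open>Z\<close> lie in other members could be
    dropped, against the minimality of \<open>card M\<close>.\<close>
  have priv: "\<exists>z\<in>Z. z \<in> e \<and> (\<forall>e'\<in>M. z \<in> e' \<longrightarrow> e' = e)" if e: "e \<in> M" for e
  proof (rule ccontr)
    assume no: "\<not> ?thesis"
    have "z \<in> \<Union>(M - {e})" if z: "z \<in> Z" for z
    proof -
      obtain f where f: "f \<in> M" "z \<in> f" using M z by auto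
      show ?thesis
      proof (cases "f = e")
        case True
        then obtain f' where "f' \<in> M" "z \<in> f'" "f' \<noteq> e" using no z f by auto
        then show ?thesis by auto
      qed (use f in auto)
    qed
    then have "Z \<subseteq> \<Union>(M - {e})" by auto
    then have "card M \<le> card (M - {e})" using M(1) by (intro min) auto
    moreover have "finite M" using M(1) assms(1) by (rule finite_subset)
    ultimately show False using e by (metis card_Diff1_less not_less)
  qed
  show ?thesis using M by (intro exI[of _ M]) (simp add: priv)
qed

text \<open>Each round spends the vertices of \<open>A\<close>, discards the edges they hit and the
  vertices left uncovered, and must lower the number of vertices plus edges by \<open>c\<close> per
  vertex spent. Only subfamilies of \<open>F\<close> arise, so \<open>reduce\<close> stays
  applicable.\<close>

lemma transversal_by_reduction:
  assumes "finite F" "finite (\<Union>F)"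
    and reduce: "\<And>G. G \<subseteq> F \<Longrightarrow> G \<noteq> {} \<Longrightarrow> \<exists>A\<subseteq>\<Union>G. A \<noteq> {} \<and>
      card (\<Union>{e\<in>G. A \<inter> e = {}}) + card {e\<in>G. A \<inter> e = {}} + c * card A \<le> card (\<Union>G) + card G"
  shows "\<exists>T\<subseteq>\<Union>F. (\<forall>e\<in>F. T \<inter> e \<noteq> {}) \<and> c * card T \<le> card (\<Union>F) + card F"
proof -
  have "\<exists>T\<subseteq>\<Union>G. (\<forall>e\<in>G. T \<inter> e \<noteq> {}) \<and> c * card T \<le> card (\<Union>G) + card G" if "G \<subseteq> F" for G
    using that
  proof (induction "card G" arbitrary: G rule: less_induct)
    case less
    show ?case
    proof (cases "G = {}")
      case True
      then show ?thesis by auto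
    next
      case False
      then obtain A where A: "A \<subseteq> \<Union>G" "A \<noteq> {}"
        and gain: "card (\<Union>{e\<in>G. A \<inter> e = {}}) + card {e\<in>G. A \<inter> e = {}} + c * card A
          \<le> card (\<Union>G) + card G"
        using reduce less.prems by meson
      let ?R = "{e\<in>G. A \<inter> e = {}}"
      have "?R \<subset> G" using A by blast
      moreover have "finite G" using less.prems assms(1) finite_subset by blast
      ultimately have "card ?R < card G" using psubset_card_mono by blast
      then obtain T where T: "T \<subseteq> \<Union>?R" "\<forall>e\<in>?R. T \<inter> e \<noteq> {}"
          "c * card T \<le> card (\<Union>?R) + card ?R"
        using less.hyps[of ?R] less.prems by fastforce
      have "c * card (T \<union> A) \<le> c * (card T + card A)" by (simp add: card_Un_le)
      also have "\<dots> \<le> card (\<Union>G) + card G" using T gain by (simp add: distrib_left)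
      finally have "c * card (T \<union> A) \<le> card (\<Union>G) + card G" .
      moreover have "T \<union> A \<subseteq> \<Union>G" "\<forall>e\<in>G. (T \<union> A) \<inter> e \<noteq> {}" using T A by auto
      ultimately show ?thesis by blast
    qed
  qed
  then show ?thesis by simp
qed

lemma card_add_le:
  assumes "finite B" "A \<union> C \<subseteq> B" "A \<inter> C = {}"
  shows "card A + card C \<le> card B"
proof -
  have "card A + card C = card (A \<union> C)"
    using assms by (intro card_Un_disjoint[symmetric]) (auto intro: finite_subset)
  then show ?thesis using assms card_mono by metis
qed

text \<open>One vertex \<open>x\<close> pays for itself if taking it removes \<open>c\<close>
  objects: the edges \<open>Q\<close> at \<open>x\<close>, and the vertices \<open>P\<close>, all of
  whose edges contain \<open>x\<close>.\<close>

lemma reduction_by_vertex: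
  assumes G: "finite G" "finite (\<Union>G)"
    and x: "x \<in> P" "P \<subseteq> \<Union>G" "Q \<subseteq> G" "card P + card Q = c"
    and Q: "\<And>f. f \<in> Q \<Longrightarrow> x \<in> f" and P: "\<And>f. f \<in> G \<Longrightarrow> x \<notin> f \<Longrightarrow> f \<inter> P = {}"
  shows "\<exists>A\<subseteq>\<Union>G. A \<noteq> {} \<and>
    card (\<Union>{e\<in>G. A \<inter> e = {}}) + card {e\<in>G. A \<inter> e = {}} + c * card A \<le> card (\<Union>G) + card G"
proof -
  have "card (\<Union>{e\<in>G. {x} \<inter> e = {}}) + card P \<le> card (\<Union>G)"
  proof (rule card_add_le)
    show "\<Union>{e\<in>G. {x} \<inter> e = {}} \<inter> P = {}" using P by fastforce
  qed (use x G in auto)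
  moreover have "card {e\<in>G. {x} \<inter> e = {}} + card Q \<le> card G"
    using x Q G by (intro card_add_le) auto
  ultimately show ?thesis using x by (intro exI[of _ "{x}"]) auto
qed

text \<open>The three objects removed are a vertex of degree at least 2 with two of its edges, or an
  edge disjoint from all others with both its ends.\<close>

lemma transversal_2_uniform:
  assumes "finite F" "\<And>e. e \<in> F \<Longrightarrow> card e = 2"
  shows "\<exists>T\<subseteq>\<Union>F. (\<forall>e\<in>F. T \<inter> e \<noteq> {}) \<and> 3 * card T \<le> card (\<Union>F) + card F"
proof (rule transversal_by_reduction)
  show finU: "finite (\<Union>F)"
    using assms by (metis card.infinite finite_Union zero_neq_numeral)
  fix G assume G: "G \<subseteq> F" "G \<noteq> {}"
  have finG: "finite G" "finite (\<Union>G)"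
    using G assms(1) finU by (meson finite_subset Union_mono)+
  obtain e where e: "e \<in> G" using G by blast
  then obtain x y where xy: "e = {x, y}" "x \<noteq> y" using assms G card_2_iff by (metis subsetD)
  consider f where "f \<in> G" "f \<noteq> e" "x \<in> f" | f where "f \<in> G" "f \<noteq> e" "y \<in> f"
    | "\<forall>f\<in>G. f \<noteq> e \<longrightarrow> f \<inter> {x, y} = {}" by blast
  then show "\<exists>A\<subseteq>\<Union>G. A \<noteq> {} \<and>
      card (\<Union>{e\<in>G. A \<inter> e = {}}) + card {e\<in>G. A \<inter> e = {}} + 3 * card A \<le> card (\<Union>G) + card G"
  proof cases
    case 1
    then show ?thesis using xy e finG by (intro reduction_by_vertex[of G x "{x}" "{e, f}"]) auto
  next
    case 2
    then show ?thesis using xy e finG by (intro reduction_by_vertex[of G y "{y}" "{e, f}"]) auto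
  next
    case 3
    then show ?thesis using xy e finG by (intro reduction_by_vertex[of G x "{x, y}" "{e}"]) auto
  qed
qed (use assms in auto)

definition star :: "'a set set \<Rightarrow> 'a \<Rightarrow> 'a set set" where
  "star G x = {e\<in>G. x \<in> e}"

text \<open>View the edges of \<open>G\<close> as nodes and the vertices of degree 2 as links between them. The set
  \<open>M\<close> is a maximum matching of this graph: a link that touches \<open>M\<close> at one end only is counted
  by \<open>sgl\<close>, and since \<open>M\<close> admits no augmenting path of length 3, each member of \<open>M\<close> meets at
  most two such links.\<close>

lemma card_degree_2_le:
  fixes G :: "'a set set"
  defines "D2 \<equiv> {x. card (star G x) = 2}"
  assumes fin: "finite G" "finite (\<Union>G)" and three: "\<And>e. e \<in> G \<Longrightarrow> card e = 3"
    and linear: "\<And>x y. x \<in> D2 \<Longrightarrow> x \<noteq> y \<Longrightarrow> star G x \<noteq> star G y"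
  obtains M where "M \<subseteq> D2" "card (\<Union>(star G ` M)) = 2 * card M" "card D2 \<le> 4 * card M"
proof -
  define indep where "indep M \<longleftrightarrow> M \<subseteq> D2 \<and> (\<forall>x\<in>M. \<forall>y\<in>M. x \<noteq> y \<longrightarrow> star G x \<inter> star G y = {})" for M
  have indep_insert: "indep (insert y N)"
    if "indep N" "y \<in> D2" "\<And>x. x \<in> N \<Longrightarrow> star G y \<inter> star G x = {}" for y N
    using that unfolding indep_def by (simp add: Int_commute)
  have "D2 \<subseteq> \<Union>G"
  proof
    fix x assume "x \<in> D2"
    then have "star G x \<noteq> {}" unfolding D2_def by auto
    then show "x \<in> \<Union>G" unfolding star_def by blast
  qed
  then have finD2: "finite D2" using fin finite_subset by blast
  have finstar: "finite (star G x)" for x unfolding star_def using fin by simp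
  have "indep M \<Longrightarrow> card M < Suc (card D2)" for M
    unfolding indep_def using finD2 by (simp add: card_mono less_Suc_eq_le)
  moreover have "indep {}" unfolding indep_def by simp
  ultimately obtain M where M: "indep M" and max: "\<And>N. indep N \<Longrightarrow> card N \<le> card M"
    using ex_has_greatest_nat[of indep "{}" card "Suc (card D2)"] by (metis less_or_eq_imp_le)
  have MD: "M \<subseteq> D2" and dis: "\<And>x y. x \<in> M \<Longrightarrow> y \<in> M \<Longrightarrow> x \<noteq> y \<Longrightarrow> star G x \<inter> star G y = {}"
    using M unfolding indep_def by auto
  have finM: "finite M" using MD finD2 finite_subset by blast
  define S where "S = \<Union>(star G ` M)"
  have finS: "finite S" unfolding S_def using finM finstar by blast
  have SG: "S \<subseteq> G" unfolding S_def star_def by blast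
  have "card S = (\<Sum>x\<in>M. card (star G x))"
    unfolding S_def using finM finstar dis by (intro card_UN_disjoint) auto
  also have "\<dots> = (\<Sum>x\<in>M. 2)" using MD unfolding D2_def by (intro sum.cong) auto
  finally have cardS: "card S = 2 * card M" by simp
  have starM: "star G x \<subseteq> S" if "x \<in> M" for x unfolding S_def using that by blast

  define sgl where "sgl = {y\<in>D2. card (star G y \<inter> S) = 1}"
  have sgl_notM: "y \<notin> M" if "y \<in> sgl" for y
  proof
    assume "y \<in> M"
    then have "star G y \<inter> S = star G y" using starM by blast
    then show False using that unfolding sgl_def D2_def by auto
  qed
  have touch: "card (star G y \<inter> S) \<ge> 1" if "y \<in> D2" for y
  proof (rule ccontr)
    assume "\<not> ?thesis"
    then have e: "star G y \<inter> S = {}" using finS by (simp add: not_le)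
    have "star G y \<noteq> {}" using that unfolding D2_def by auto
    then have y: "y \<notin> M" using starM[of y] e by blast
    have d: "star G y \<inter> star G x = {}" if "x \<in> M" for x using e starM[OF that] by blast
    have "indep (insert y M)" using M that d by (rule indep_insert)
    then have "card (insert y M) \<le> card M" by (rule max)
    then show False using finM y by simp
  qed

  have sgl_edges: "\<exists>h q. star G y = {h, q} \<and> h \<in> star G m \<and> star G y \<inter> S = {h} \<and> q \<notin> S"
    if y: "y \<in> sgl" and m: "m \<in> M" "star G y \<inter> star G m \<noteq> {}" for y m
  proof -
    have "card (star G y \<inter> S) = 1" using y unfolding sgl_def by blast
    then obtain h where h: "star G y \<inter> S = {h}" by (metis card_1_singletonE)
    obtain x where x: "x \<in> star G y" "x \<in> star G m" using m by auto
    then have "x \<in> star G y \<inter> S" using starM[OF m(1)] by auto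
    then have "h \<in> star G m" using x h by simp
    have "card (star G y) = 2" using y unfolding sgl_def D2_def by blast
    then obtain p q where pq: "star G y = {p, q}" "p \<noteq> q" unfolding card_2_iff by metis
    have "h \<in> star G y" using h by auto
    then consider "h = p" | "h = q" using pq by auto
    then show ?thesis
    proof cases
      case 1
      then have "q \<notin> S" using h pq by auto
      then show ?thesis using 1 h pq \<open>h \<in> star G m\<close> by metis
    next
      case 2
      then have "p \<notin> S" using h pq by auto
      then show ?thesis using 2 h pq \<open>h \<in> star G m\<close> by (metis insert_commute)
    qed
  qed

  have two: "card {y\<in>sgl. star G y \<inter> star G m \<noteq> {}} \<le> 2" if m: "m \<in> M" for m
  proof (rule ccontr)
    assume "\<not> ?thesis"
    then have "3 \<le> card {y\<in>sgl. star G y \<inter> star G m \<noteq> {}}" by simp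
    from obtain_subset_with_card_n[OF this] obtain X
      where X: "X \<subseteq> {y\<in>sgl. star G y \<inter> star G m \<noteq> {}}" "card X = 3" .
    have "\<forall>y\<in>X. \<exists>h q. star G y = {h, q} \<and> h \<in> star G m \<and> star G y \<inter> S = {h} \<and> q \<notin> S"
      using X by (intro ballI sgl_edges m) auto
    then obtain h q where hq: "\<And>y. y \<in> X \<Longrightarrow> star G y = {h y, q y} \<and> h y \<in> star G m \<and> star G y \<inter> S = {h y} \<and> q y \<notin> S"
      by metis
    have XM: "X \<inter> M = {}" "X \<subseteq> D2" using X sgl_notM unfolding sgl_def by auto
    \<comment> \<open>Here \<open>h\<close> is the matched end of a link and \<open>q\<close> its
      free end. Links sharing \<open>h\<close> differ in \<open>q\<close> by \<open>linear\<close>;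
      links with different \<open>h\<close> must agree in \<open>q\<close>, since otherwise
      replacing \<open>m\<close> by both of them enlarges the matching.\<close>
    have same: "q a \<noteq> q b" if "a \<in> X" "b \<in> X" "a \<noteq> b" "h a = h b" for a b
      using linear[of a b] XM that hq by (metis subsetD)
    have diff: "q a = q b" if ab: "a \<in> X" "b \<in> X" "h a \<noteq> h b" for a b
    proof (rule ccontr)
      assume q: "q a \<noteq> q b"
      let ?N = "insert a (insert b (M - {m}))"
      have off: "star G y \<inter> star G x = {}" if "y \<in> X" "x \<in> M - {m}" for x y
      proof -
        have x: "x \<in> M" "m \<noteq> x" using that by auto
        have "star G y \<inter> star G x \<subseteq> star G y \<inter> S" using starM[OF x(1)] by auto
        also have "\<dots> = {h y}" using hq that(1) by metis
        finally have "star G y \<inter> star G x \<subseteq> {h y}" .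
        moreover have "h y \<in> star G m" using hq that(1) by metis
        then have "h y \<notin> star G x" using dis[OF m x] by auto
        ultimately show ?thesis by auto
      qed
      have qS: "q a \<notin> S" "q b \<notin> S" "h a \<in> S" "h b \<in> S" using hq[OF ab(1)] hq[OF ab(2)] starM[OF m] by auto
      have "star G a \<inter> star G b = {}"
        using hq[OF ab(1)] hq[OF ab(2)] ab(3) q qS by auto
      moreover have "indep (M - {m})" using M unfolding indep_def by auto
      moreover have "a \<in> D2" "b \<in> D2" using XM ab by auto
      ultimately have "indep ?N"
        using off ab by (intro indep_insert) auto
      then have "card ?N \<le> card M" by (rule max)
      moreover have "a \<noteq> b" "a \<notin> M" "b \<notin> M" using ab XM by auto
      then have "card ?N = Suc (Suc (card (M - {m})))" using finM by simp
      moreover have "card M = Suc (card (M - {m}))" using finM m by (rule card.remove)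
      ultimately show False by linarith
    qed
    obtain a b c where abc: "X = {a, b, c}" "a \<noteq> b" "a \<noteq> c" "b \<noteq> c"
      using X(2) unfolding card_3_iff by metis
    have "card (star G m) = 2" using m MD unfolding D2_def by blast
    then obtain e f where ef: "star G m = {e, f}" unfolding card_2_iff by metis
    \<comment> \<open>If all three links had the same matched end, that edge of size 3 would contain
      \<open>m\<close>, \<open>a\<close>, \<open>b\<close> and \<open>c\<close>. So two of them
      share a matched end and the third does not; its free end would equal both of theirs, which are
      distinct.\<close>
    have "\<not> (h a = h b \<and> h b = h c)"
    proof
      assume eq: "h a = h b \<and> h b = h c"
      have "h a \<in> star G a" "h b \<in> star G b" "h c \<in> star G c" "h a \<in> star G m" using hq abc by auto
      then have sub: "{m, a, b, c} \<subseteq> h a" and "h a \<in> G" using eq unfolding star_def by auto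
      have "m \<notin> X" using m XM by blast
      then have "card {m, a, b, c} = 4" using abc by simp
      moreover have c3: "card (h a) = 3" by (rule three) fact
      moreover have "finite (h a)" using c3 by (metis card.infinite zero_neq_numeral)
      ultimately show False using card_mono[OF _ sub] by simp
    qed
    moreover have "h a \<in> {e, f}" "h b \<in> {e, f}" "h c \<in> {e, f}" using hq abc ef by auto
    moreover have False if "x \<in> X" "y \<in> X" "z \<in> X" "x \<noteq> y" "h x = h y" "h z \<noteq> h x" for x y z
      using same[of x y] diff[of z x] diff[of z y] that by metis
    ultimately show False
      using abc by (metis insertE insertI1 insertI2 singletonD)
  qed

  have sgl_fin: "finite sgl" unfolding sgl_def using finD2 by simp
  have "sgl \<subseteq> (\<Union>m\<in>M. {y\<in>sgl. star G y \<inter> star G m \<noteq> {}})"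
  proof
    fix y assume y: "y \<in> sgl"
    then have "star G y \<inter> S \<noteq> {}" unfolding sgl_def by auto
    then show "y \<in> (\<Union>m\<in>M. {y\<in>sgl. star G y \<inter> star G m \<noteq> {}})" using y unfolding S_def by blast
  qed
  then have "card sgl \<le> card (\<Union>m\<in>M. {y\<in>sgl. star G y \<inter> star G m \<noteq> {}})"
    using finM sgl_fin by (intro card_mono) auto
  also have "\<dots> \<le> (\<Sum>m\<in>M. card {y\<in>sgl. star G y \<inter> star G m \<noteq> {}})"
    using finM by (rule card_UN_le)
  also have "\<dots> \<le> (\<Sum>m\<in>M. 2)" by (intro sum_mono two)
  finally have sgl_le: "card sgl \<le> 2 * card M" by simp

  \<comment> \<open>Double counting of incidences between \<open>D2\<close> and \<open>S\<close>:
    each vertex of \<open>D2\<close> gives two, or one if it is in \<open>sgl\<close>, and each edge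
    of \<open>S\<close> receives at most three. Hence \<open>2 |D2|\<close> is at most
    \<open>3 |S| + |sgl|\<close>, thus at most \<open>6 |M| + 2 |M|\<close>.\<close>
  have "2 * card D2 = (\<Sum>y\<in>D2. 2)" by simp
  also have "\<dots> \<le> (\<Sum>y\<in>D2. card (star G y \<inter> S) + (if y \<in> sgl then 1 else 0))"
  proof (rule sum_mono)
    fix y assume "y \<in> D2"
    then show "2 \<le> card (star G y \<inter> S) + (if y \<in> sgl then 1 else 0)"
      using touch[of y] unfolding sgl_def by auto
  qed
  also have "\<dots> = (\<Sum>y\<in>D2. card (star G y \<inter> S)) + card sgl"
  proof -
    have "D2 \<inter> {y. y \<in> sgl} = sgl" unfolding sgl_def by blast
    then show ?thesis using finD2 by (simp add: sum.distrib sum.If_cases)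
  qed
  also have "(\<Sum>y\<in>D2. card (star G y \<inter> S)) = (\<Sum>y\<in>D2. \<Sum>e\<in>S. if y \<in> e then 1 else 0)"
  proof (rule sum.cong)
    fix y
    have "star G y \<inter> S = S \<inter> {e. y \<in> e}" using SG unfolding star_def by blast
    then show "card (star G y \<inter> S) = (\<Sum>e\<in>S. if y \<in> e then 1 else 0)"
      using finS by (simp add: sum.If_cases)
  qed simp
  also have "\<dots> = (\<Sum>e\<in>S. \<Sum>y\<in>D2. if y \<in> e then 1 else 0)" by (rule sum.swap)
  also have "\<dots> \<le> (\<Sum>e\<in>S. 3)"
  proof (rule sum_mono)
    fix e assume "e \<in> S"
    then have "card e = 3" using SG three by blast
    moreover have "finite e" using \<open>card e = 3\<close> by (metis card.infinite zero_neq_numeral)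
    ultimately have "card (D2 \<inter> {y. y \<in> e}) \<le> 3" using card_mono[of e "D2 \<inter> {y. y \<in> e}"] by simp
    then show "(\<Sum>y\<in>D2. if y \<in> e then 1 else 0) \<le> (3::nat)"
      using finD2 by (simp add: sum.If_cases)
  qed
  finally have "2 * card D2 \<le> 8 * card M" using sgl_le cardS by simp
  then show thesis using that[of M] MD cardS unfolding S_def by simp
qed

lemma sum_degrees:
  assumes "finite G" "finite (\<Union>G)"
  shows "(\<Sum>x\<in>\<Union>G. card (star G x)) = (\<Sum>e\<in>G. card e)"
proof -
  have "(\<Sum>x\<in>\<Union>G. card (star G x)) = (\<Sum>x\<in>\<Union>G. \<Sum>e\<in>G. if x \<in> e then 1 else 0)"
    using assms by (simp add: star_def sum.If_cases Int_def)
  also have "\<dots> = (\<Sum>e\<in>G. \<Sum>x\<in>\<Union>G. if x \<in> e then 1 else 0)" by (rule sum.swap)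
  also have "\<dots> = (\<Sum>e\<in>G. card e)"
  proof (rule sum.cong)
    fix e assume "e \<in> G"
    then have "\<Union>G \<inter> {x. x \<in> e} = e" by auto
    then show "(\<Sum>x\<in>\<Union>G. if x \<in> e then 1 else 0) = card e"
      using assms by (simp add: sum.If_cases)
  qed simp
  finally show ?thesis .
qed

text \<open>A greedy step works at a vertex of degree at least 3 (one vertex, three edges) and at
  two vertices with the same two edges (two vertices, two edges). Otherwise the links form a simple
  graph on the edges, and a maximum matching yields a transversal of the whole family at
  once.\<close>

lemma transversal_3_uniform:
  assumes F: "finite F" "\<And>e. e \<in> F \<Longrightarrow> card e = 3"
  shows "\<exists>T\<subseteq>\<Union>F. (\<forall>e\<in>F. T \<inter> e \<noteq> {}) \<and> 4 * card T \<le> card (\<Union>F) + card F"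
proof (rule transversal_by_reduction)
  show "finite F" by fact
  show finU: "finite (\<Union>F)"
    using F by (metis card.infinite finite_Union zero_neq_numeral)
  fix G assume G: "G \<subseteq> F" "G \<noteq> {}"
  have finG: "finite G" "finite (\<Union>G)"
    using G F(1) finU by (meson finite_subset Union_mono)+
  have three: "\<And>e. e \<in> G \<Longrightarrow> card e = 3" using F G by auto
  define D2 where "D2 = {x. card (star G x) = 2}"
  have star_mem: "x \<in> \<Union>G" if "card (star G x) \<noteq> 0" for x
  proof -
    have "star G x \<noteq> {}" using that by (metis card.empty)
    then show ?thesis unfolding star_def by auto
  qed
  consider (big) x where "3 \<le> card (star G x)"
    | (twin) x y where "\<And>x. card (star G x) \<le> 2" "x \<in> D2" "x \<noteq> y" "star G x = star G y"
    | (linear) "\<And>x. card (star G x) \<le> 2" "\<And>x y. x \<in> D2 \<Longrightarrow> x \<noteq> y \<Longrightarrow> star G x \<noteq> star G y"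
  proof (cases "\<exists>x. 3 \<le> card (star G x)")
    case True
    then show thesis using big by auto
  next
    case False
    then have le: "card (star G x) \<le> 2" for x
      by (metis not_less_eq_eq numeral_2_eq_2 numeral_3_eq_3)
    show thesis
    proof (cases "\<exists>x y. x \<in> D2 \<and> x \<noteq> y \<and> star G x = star G y")
      case True
      then show thesis using twin le by auto
    next
      case False
      then show thesis using linear le by metis
    qed
  qed
  then show "\<exists>A\<subseteq>\<Union>G. A \<noteq> {} \<and>
      card (\<Union>{e\<in>G. A \<inter> e = {}}) + card {e\<in>G. A \<inter> e = {}} + 4 * card A \<le> card (\<Union>G) + card G"
  proof cases
    case big
    from obtain_subset_with_card_n[OF this] obtain Q where "Q \<subseteq> star G x" "card Q = 3" .
    moreover have "x \<in> \<Union>G" using star_mem[of x] big by simp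
    ultimately show ?thesis
      using finG unfolding star_def
      by (intro reduction_by_vertex[of G x "{x}" Q]) auto
  next
    case twin
    have "card (star G x) = 2" using twin(2) unfolding D2_def by simp
    moreover have "x \<in> \<Union>G" "y \<in> \<Union>G"
      using star_mem[of x] star_mem[of y] twin(4) calculation by simp_all
    moreover have "y \<notin> f" if "f \<in> G" "x \<notin> f" for f
    proof
      assume "y \<in> f"
      then have "f \<in> star G y" using that unfolding star_def by simp
      then have "f \<in> star G x" using twin(4) by simp
      then show False using that unfolding star_def by simp
    qed
    ultimately show ?thesis
      using finG twin(3)
      by (intro reduction_by_vertex[of G x "{x, y}" "star G x"]) (auto simp: star_def)
  next
    case linear
    obtain M where M: "M \<subseteq> D2" and S: "card (\<Union>(star G ` M)) = 2 * card M"
      and D2: "card D2 \<le> 4 * card M"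
      using card_degree_2_le[OF finG three linear(2)[unfolded D2_def]] unfolding D2_def by metis
    define S where "S = \<Union>(star G ` M)"
    have "S \<subseteq> G" unfolding S_def star_def by auto
    have D2U: "D2 \<subseteq> \<Union>G" using star_mem unfolding D2_def by auto
    then have finM: "finite M" using M finG finite_subset by metis
    have "\<forall>e\<in>G - S. \<exists>x. x \<in> e" using three by (metis DiffD1 all_not_in_conv card.empty zero_neq_numeral)
    then obtain p where p: "\<And>e. e \<in> G - S \<Longrightarrow> p e \<in> e" by metis
    \<comment> \<open>A matched link hits two edges, every other edge costs one vertex, so
      \<open>|T|\<close> is at most \<open>|G| - |M|\<close>. Summing degrees bounds
      \<open>3 |G|\<close> by \<open>|\<Union>G| + |D2|\<close>, hence by
      \<open>|\<Union>G| + 4 |M|\<close>; the two terms \<open>4 |M|\<close> cancel.\<close>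
    define T where "T = M \<union> p ` (G - S)"
    have "T \<subseteq> \<Union>G" unfolding T_def using M D2U p by blast
    moreover have hit: "T \<inter> e \<noteq> {}" if "e \<in> G" for e
    proof (cases "e \<in> S")
      case True
      then show ?thesis unfolding T_def S_def star_def by auto
    next
      case False
      then have "p e \<in> T \<inter> e" unfolding T_def using p that by auto
      then show ?thesis by auto
    qed
    moreover have "T \<noteq> {}" using hit G by auto
    moreover have "4 * card T \<le> card (\<Union>G) + card G"
    proof -
      have "card T \<le> card M + card (p ` (G - S))" unfolding T_def by (rule card_Un_le)
      also have "\<dots> \<le> card M + card (G - S)" using finG(1) by (simp add: card_image_le)
      also have "card (G - S) = card G - 2 * card M"
        using S \<open>S \<subseteq> G\<close> finG unfolding S_def by (simp add: card_Diff_subset finite_subset)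
      finally have T: "card T \<le> card M + (card G - 2 * card M)" .
      have le: "2 * card M \<le> card G"
        using S \<open>S \<subseteq> G\<close> finG(1) card_mono unfolding S_def by metis
      have "3 * card G = (\<Sum>x\<in>\<Union>G. card (star G x))"
        using sum_degrees[OF finG] three by simp
      also have "\<dots> \<le> (\<Sum>x\<in>\<Union>G. 1 + (if x \<in> D2 then 1 else 0))"
      proof (rule sum_mono)
        fix x
        show "card (star G x) \<le> 1 + (if x \<in> D2 then 1 else 0)" using linear(1)[of x] unfolding D2_def by auto
      qed
      also have "\<dots> = card (\<Union>G) + card (\<Union>G \<inter> D2)"
        using finG by (simp only: sum.distrib) (simp add: sum.If_cases)
      also have "\<Union>G \<inter> D2 = D2" using D2U by (rule Int_absorb1)
      finally show ?thesis using T D2 le by linarith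
    qed
    moreover have none: "{e\<in>G. T \<inter> e = {}} = {}" using hit by auto
    ultimately show ?thesis by (intro exI[of _ T]) (simp add: none del: Collect_empty_eq)
  qed
qed

text \<open>In a minimal subcover every edge has a private vertex. Deleting one private vertex from each
  edge gives an (r-1)-uniform hypergraph, each of whose transversals dominates everything.\<close>

lemma dominating_3_4_uniform:
  assumes r: "r \<in> {3, 4}" and K: "finite K" "\<And>e. e \<in> K \<Longrightarrow> card e = r"
  obtains T where "T \<subseteq> \<Union>K" "\<And>x. x \<in> \<Union>K \<Longrightarrow> \<exists>e\<in>K. x \<in> e \<and> T \<inter> e \<noteq> {}" "r * card T \<le> card (\<Union>K)"
proof -
  obtain F where F: "F \<subseteq> K" "\<Union>K \<subseteq> \<Union>F"
    and priv: "\<forall>e\<in>F. \<exists>z\<in>\<Union>K. z \<in> e \<and> (\<forall>e'\<in>F. z \<in> e' \<longrightarrow> e' = e)"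
    using minimal_subcover[OF K(1) subset_refl] by metis
  have "\<forall>e\<in>F. \<exists>z. z \<in> e \<and> (\<forall>e'\<in>F. z \<in> e' \<longrightarrow> e' = e)"
    using priv by metis
  then obtain p where p: "\<And>e. e \<in> F \<Longrightarrow> p e \<in> e"
      "\<And>e e'. e \<in> F \<Longrightarrow> e' \<in> F \<Longrightarrow> p e \<in> e' \<Longrightarrow> e' = e"
    by metis
  have finF: "finite F" using F(1) K(1) by (rule finite_subset)
  have fine: "finite e" if "e \<in> F" for e
    using K(2)[of e] that F(1) r by (metis card.infinite insertE singletonD subsetD zero_neq_numeral)
  have finU: "finite (\<Union>F)" using finF fine by auto
  define F' where "F' = (\<lambda>e. e - {p e}) ` F"
  have "finite F'" unfolding F'_def using finF by simp
  moreover have "card e = r - 1" if "e \<in> F'" for e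
    using that p(1) F K(2) fine unfolding F'_def by auto
  ultimately have "\<exists>T\<subseteq>\<Union>F'. (\<forall>e\<in>F'. T \<inter> e \<noteq> {}) \<and> r * card T \<le> card (\<Union>F') + card F'"
    using r transversal_2_uniform[of F'] transversal_3_uniform[of F'] by auto
  then obtain T where T: "T \<subseteq> \<Union>F'" "\<And>e. e \<in> F' \<Longrightarrow> T \<inter> e \<noteq> {}"
    and le: "r * card T \<le> card (\<Union>F') + card F'" by auto
  \<comment> \<open>The deleted vertices are distinct, one for each edge, and lie outside
    \<open>\<Union>F'\<close>; they make up for the term \<open>card F'\<close>.\<close>
  have "inj_on p F" using p by (metis inj_onI)
  then have "card F' \<le> card (p ` F)"
    unfolding F'_def using finF by (simp add: card_image card_image_le)
  moreover have "card (\<Union>F') + card (p ` F) \<le> card (\<Union>F)"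
  proof (rule card_add_le[OF finU])
    show "\<Union>F' \<union> p ` F \<subseteq> \<Union>F" unfolding F'_def using p(1) by auto
    show "\<Union>F' \<inter> p ` F = {}" unfolding F'_def using p(2) by auto
  qed
  moreover have "\<Union>F = \<Union>K" using F by auto
  ultimately have "r * card T \<le> card (\<Union>K)" using le by simp
  moreover have "T \<subseteq> \<Union>K" using T(1) \<open>\<Union>F = \<Union>K\<close> unfolding F'_def by auto
  moreover have "\<exists>e\<in>K. x \<in> e \<and> T \<inter> e \<noteq> {}" if "x \<in> \<Union>K" for x
  proof -
    have "x \<in> \<Union>F" using F(2) that by (rule subsetD)
    then obtain e where e: "e \<in> F" "x \<in> e" by auto
    have "T \<inter> (e - {p e}) \<noteq> {}" using T(2) e unfolding F'_def by simp
    then show ?thesis using e F(1) by auto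
  qed
  ultimately show thesis using that by metis
qed

subsection \<open>Forcing\<close>

text \<open>The covering condition of the forcing rule, for an arbitrary target. The target may
  contain \<open>v\<close> itself, so for \<open>k = 0\<close> even the private neighborhood
  \<open>{v}\<close> is not coverable.\<close>

definition star_coverable :: "'a set set \<Rightarrow> nat \<Rightarrow> 'a \<Rightarrow> 'a set \<Rightarrow> bool" where
  "star_coverable E k v Z \<longleftrightarrow>
    (\<exists>F\<subseteq>E. finite F \<and> card F \<le> k \<and> (\<forall>e\<in>F. v \<in> e) \<and> Z \<subseteq> \<Union>F)"

text \<open>Allowing overshoot makes the relation composable: from a larger blue set, the same
  forcing vertices may color more than planned.\<close>

definition reaches :: "'a set set \<Rightarrow> nat \<Rightarrow> 'a set \<Rightarrow> 'a set \<Rightarrow> bool" where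
  "reaches E k B C \<longleftrightarrow> (\<exists>C'. C \<subseteq> C' \<and> (forcing_step E k)\<^sup>*\<^sup>* B C')"

lemma star_coverable_subset:
  "star_coverable E k v Z \<Longrightarrow> Y \<subseteq> Z \<Longrightarrow> star_coverable E k v Y"
  unfolding star_coverable_def by (meson subset_trans)

text \<open>A larger blue set leaves fewer white neighbors, which the same edges still cover, so
  every step can be replayed.\<close>

lemma forcing_steps_mono:
  assumes "(forcing_step E k)\<^sup>*\<^sup>* B C" "B \<subseteq> B'"
  shows "\<exists>C'. C \<subseteq> C' \<and> (forcing_step E k)\<^sup>*\<^sup>* B' C'"
  using assms
proof (induction rule: rtranclp_induct)
  case base
  then show ?case by (intro exI[of _ B']) simp
next
  case (step Y Z)
  from step.IH[OF step.prems] obtain Y' where Y': "Y \<subseteq> Y'" "(forcing_step E k)\<^sup>*\<^sup>* B' Y'"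
    by metis
  from step.hyps(2) obtain v F where v: "v \<in> Y"
    and F: "F \<subseteq> E" "finite F" "card F \<le> k" "\<forall>e\<in>F. v \<in> e" "neighbors E v - Y \<subseteq> \<Union>F"
    and Z: "Z = Y \<union> (neighbors E v - Y)"
    unfolding forcing_step_def by blast
  have "neighbors E v - Y' \<subseteq> \<Union>F" using F Y' by blast
  then have "forcing_step E k Y' (Y' \<union> (neighbors E v - Y'))"
    unfolding forcing_step_def using v F Y' by blast
  moreover have "Z \<subseteq> Y' \<union> (neighbors E v - Y')" using Z Y' by blast
  ultimately show ?case using Y' by (meson rtranclp.rtrancl_into_rtrancl)
qed

lemma reaches_subset: "C \<subseteq> B \<Longrightarrow> reaches E k B C"
  unfolding reaches_def by (intro exI[of _ B]) simp

lemma reaches_trans: "reaches E k A B \<Longrightarrow> reaches E k B C \<Longrightarrow> reaches E k A C"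
  unfolding reaches_def by (meson forcing_steps_mono rtranclp_trans subset_trans)

lemma reaches_Un:
  assumes "reaches E k B C" "reaches E k B C'"
  shows "reaches E k B (C \<union> C')"
proof -
  obtain X where X: "C \<subseteq> X" "(forcing_step E k)\<^sup>*\<^sup>* B X" using assms unfolding reaches_def by metis
  have "B \<subseteq> X" using X(2)
    by (induction rule: rtranclp_induct) (auto simp: forcing_step_def)
  then have "reaches E k X C'"
    using assms reaches_subset reaches_trans by blast
  then obtain Y where Y: "C' \<subseteq> Y" "(forcing_step E k)\<^sup>*\<^sup>* X Y" unfolding reaches_def by metis
  have "X \<subseteq> Y" using Y(2)
    by (induction rule: rtranclp_induct) (auto simp: forcing_step_def)
  then show ?thesis using X Y unfolding reaches_def by (meson Un_least rtranclp_trans subset_trans)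
qed

lemma reaches_neighbors:
  assumes "v \<in> B" "star_coverable E k v (neighbors E v - B)"
  shows "reaches E k B (B \<union> neighbors E v)"
proof -
  have "forcing_step E k B (B \<union> (neighbors E v - B))"
    using assms unfolding forcing_step_def star_coverable_def by blast
  then show ?thesis unfolding reaches_def by (intro exI[of _ "B \<union> (neighbors E v - B)"]) auto
qed

lemma adjacent_sym: "adjacent E u v \<Longrightarrow> adjacent E v u"
  unfolding adjacent_def by blast

lemma closed_neighborhood_insert:
  "closed_neighborhood E (insert v S) = insert v (neighbors E v) \<union> closed_neighborhood E S"
  unfolding closed_neighborhood_def by auto

lemma closed_neighborhood_mono: "S \<subseteq> T \<Longrightarrow> closed_neighborhood E S \<subseteq> closed_neighborhood E T"
  unfolding closed_neighborhood_def by blast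

lemma subset_closed_neighborhood: "S \<subseteq> closed_neighborhood E S"
  unfolding closed_neighborhood_def by blast

lemma edge_subset_closed_neighborhood:
  "e \<in> E \<Longrightarrow> v \<in> e \<Longrightarrow> v \<in> S \<Longrightarrow> e \<subseteq> closed_neighborhood E S"
  unfolding closed_neighborhood_def neighbors_def adjacent_def by blast

lemma closed_neighborhood_subset_vertices:
  assumes "hypergraph V E" "S \<subseteq> V"
  shows "closed_neighborhood E S \<subseteq> V"
  using assms by (auto simp: hypergraph_def closed_neighborhood_def neighbors_def adjacent_def)

lemma power_dominating_iff_reaches:
  assumes "hypergraph V E"
  shows "power_dominating V E k D \<longleftrightarrow> D \<subseteq> V \<and> reaches E k (closed_neighborhood E D) V"
proof -
  have nb: "neighbors E v \<subseteq> V" for v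
    using assms unfolding hypergraph_def neighbors_def adjacent_def by blast
  have "C \<subseteq> V" if "(forcing_step E k)\<^sup>*\<^sup>* (closed_neighborhood E D) C" "D \<subseteq> V" for C
    using that
  proof (induction rule: rtranclp_induct)
    case base
    then show ?case using closed_neighborhood_subset_vertices[OF assms] by blast
  next
    case (step Y Z)
    then show ?case using nb unfolding forcing_step_def by blast
  qed
  then show ?thesis
    unfolding power_dominating_def reaches_def by (metis subset_antisym subset_refl)
qed

lemma power_dominating_vertices: "hypergraph V E \<Longrightarrow> power_dominating V E k V"
  by (simp add: power_dominating_iff_reaches reaches_subset subset_closed_neighborhood)

text \<open>Instead of dominating, \<open>v\<close> can force: once it is blue, \<open>k\<close>
  edges cover what the other members leave white around it. So \<open>v\<close> may be dropped if
  another member dominates it, or be replaced by a neighbor.\<close>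

lemma power_dominating_exchange:
  assumes H: "hypergraph V E" and D: "power_dominating V E k D" and "v \<in> D"
    and D': "D' \<subseteq> V" "D - {v} \<subseteq> D'" "v \<in> closed_neighborhood E D'"
    and cov: "star_coverable E k v (insert v (neighbors E v) - closed_neighborhood E (D - {v}))"
  shows "power_dominating V E k D'"
proof -
  let ?B = "closed_neighborhood E D'"
  have sub: "closed_neighborhood E (D - {v}) \<subseteq> ?B" using D' closed_neighborhood_mono by blast
  then have "star_coverable E k v (neighbors E v - ?B)"
    using star_coverable_subset[OF cov] by blast
  then have "reaches E k ?B (?B \<union> neighbors E v)" using D' reaches_neighbors by metis
  moreover have "closed_neighborhood E D \<subseteq> ?B \<union> neighbors E v"
    using closed_neighborhood_insert[of E v "D - {v}"] insert_Diff[OF \<open>v \<in> D\<close>] sub D'(3)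
    by auto
  ultimately have "reaches E k ?B (closed_neighborhood E D)"
    by (meson reaches_subset reaches_trans)
  then show ?thesis using D D'(1) reaches_trans unfolding power_dominating_iff_reaches[OF H] by blast
qed

subsection \<open>Extremal power dominating sets\<close>

lemma star_subset_closed_neighborhood: "\<Union>(star E v) \<subseteq> insert v (neighbors E v)"
  unfolding star_def neighbors_def adjacent_def by auto

lemma neighbors_subset_star: "neighbors E v \<subseteq> \<Union>(star E v)"
  unfolding star_def neighbors_def adjacent_def by auto

text \<open>The vertices of \<open>S\<close> force one after another, and \<open>B\<close> collects the closed neighborhoods of those
  that have already forced. The edges are chosen in the opposite order: the edges at \<open>v\<close> avoid the
  vertices left white by later forcers, since those lie outside the closed neighborhood of \<open>v\<close>, and
  they only have to cover what the edges of the later forcers miss. That remainder contains the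
  private neighborhood of \<open>v\<close>, so a minimal cover has more than \<open>k\<close> edges, \<open>k\<close> of which are dropped.\<close>

lemma forcing_edge_set:
  assumes H: "hypergraph V E" and "finite S" "S \<subseteq> V"
    and edge: "\<And>v. v \<in> S \<Longrightarrow> star E v \<noteq> {}"
    and priv: "\<And>v. v \<in> S \<Longrightarrow>
      \<not> star_coverable E k v (insert v (neighbors E v) - closed_neighborhood E (S - {v}) - B)"
  shows "\<exists>K\<subseteq>E. S \<subseteq> \<Union>K \<and> \<Union>K \<subseteq> closed_neighborhood E S \<and>
    k * card S \<le> card (closed_neighborhood E S - B - \<Union>K) \<and>
    reaches E k (B \<union> \<Union>K) (B \<union> closed_neighborhood E S)"
  using assms(2-)
proof (induction S arbitrary: B rule: finite_induct)
  case empty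
  have "reaches E k B (B \<union> closed_neighborhood E {})"
    by (rule reaches_subset) (simp add: closed_neighborhood_def)
  then show ?case by (intro exI[of _ "{}"]) simp
next
  case (insert v S)
  let ?cn = "closed_neighborhood E"
  define N where "N = insert v (neighbors E v)"
  have finE: "finite E" using H unfolding hypergraph_def by (meson finite_Pow_iff finite_subset)
  have cn_insert: "?cn (insert v S) = N \<union> ?cn S"
    unfolding N_def by (rule closed_neighborhood_insert)
  have finV: "finite (?cn (insert v S))"
    using closed_neighborhood_subset_vertices[OF H insert.prems(1)] H
    unfolding hypergraph_def by (meson finite_subset)
  \<comment> \<open>As \<open>v\<close> forces first, \<open>N\<close> is already blue for the
    others and joins \<open>B\<close>; their private neighborhoods stay the same.\<close>
  have "\<not> star_coverable E k w (insert w (neighbors E w) - ?cn (S - {w}) - (B \<union> N))" if "w \<in> S" for w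
  proof -
    have "insert v S - {w} = insert v (S - {w})" using that insert.hyps by auto
    then have "?cn (insert v S - {w}) = N \<union> ?cn (S - {w})"
      using closed_neighborhood_insert unfolding N_def by metis
    then have "insert w (neighbors E w) - ?cn (S - {w}) - (B \<union> N)
        = insert w (neighbors E w) - ?cn (insert v S - {w}) - B" by auto
    then show ?thesis using insert.prems(3)[of w] that by simp
  qed
  then obtain K' where K': "K' \<subseteq> E" "S \<subseteq> \<Union>K'" "\<Union>K' \<subseteq> ?cn S"
      "k * card S \<le> card (?cn S - (B \<union> N) - \<Union>K')" "reaches E k ((B \<union> N) \<union> \<Union>K') ((B \<union> N) \<union> ?cn S)"
    using insert.IH[of "B \<union> N"] insert.prems(1,2) by auto
  define Z where "Z = N - B - \<Union>K'"
  have "N \<subseteq> \<Union>(star E v)"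
    using neighbors_subset_star[of E v] insert.prems(2)[of v] unfolding N_def star_def by auto
  then have Zsub: "Z \<subseteq> \<Union>(star E v)" unfolding Z_def by auto
  have "finite (star E v)" using finE unfolding star_def by simp
  from minimal_subcover[OF this Zsub] obtain M where M: "M \<subseteq> star E v" "Z \<subseteq> \<Union>M"
    and Mpriv: "\<forall>e\<in>M. \<exists>z\<in>Z. z \<in> e \<and> (\<forall>e'\<in>M. z \<in> e' \<longrightarrow> e' = e)" by metis
  have finM: "finite M" using M(1) \<open>finite (star E v)\<close> by (rule finite_subset)
  have ME: "M \<subseteq> E" and Mv: "\<And>e. e \<in> M \<Longrightarrow> v \<in> e" using M(1) unfolding star_def by auto
  have MN: "\<Union>M \<subseteq> N" using M(1) star_subset_closed_neighborhood[of E v] unfolding N_def by auto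
  have "\<not> star_coverable E k v Z"
  proof
    assume "star_coverable E k v Z"
    moreover have "insert v S - {v} = S" using insert.hyps by auto
    then have "N - ?cn (insert v S - {v}) - B \<subseteq> Z" unfolding Z_def using K'(3) by auto
    ultimately show False
      using insert.prems(3)[of v] star_coverable_subset unfolding N_def by (metis insertI1)
  qed
  then have "k < card M"
    using ME Mv M(2) finM unfolding star_coverable_def by (meson not_less)
  then have "k \<le> card M" by simp
  from obtain_subset_with_card_n[OF this] obtain L where L: "L \<subseteq> M" "card L = k" .
  have finL: "finite L" using L(1) finM by (rule finite_subset)
  \<comment> \<open>The strict bound matters: an edge at \<open>v\<close> survives and makes
    \<open>v\<close> blue, as it must be in order to force.\<close>
  have "M - L \<noteq> {}" using L \<open>k < card M\<close> by (metis Diff_eq_empty_iff less_irrefl subset_antisym)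
  define K where "K = K' \<union> (M - L)"
  have vK: "v \<in> \<Union>K" using \<open>M - L \<noteq> {}\<close> Mv unfolding K_def by auto
  \<comment> \<open>Private vertices of the \<open>k\<close> dropped edges lie in no kept edge. They
    belong to \<open>N\<close>, so they are not among the vertices counted for the later forcers,
    which lie outside \<open>N\<close>.\<close>
  define T where "T = Z - \<Union>(M - L)"
  have "k \<le> card T"
  proof -
    obtain z where z: "\<And>e. e \<in> M \<Longrightarrow> z e \<in> Z" "\<And>e. e \<in> M \<Longrightarrow> z e \<in> e"
        "\<And>e e'. e \<in> M \<Longrightarrow> e' \<in> M \<Longrightarrow> z e \<in> e' \<Longrightarrow> e' = e"
      using Mpriv by metis
    have "inj_on z L" using z L(1) by (metis inj_onI subsetD)
    moreover have "z ` L \<subseteq> T"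
    proof
      fix x assume "x \<in> z ` L"
      then obtain e where e: "e \<in> L" "x = z e" by auto
      then have "e \<in> M" using L(1) by auto
      then show "x \<in> T" using z(1)[of e] z(3)[of e] e unfolding T_def by auto
    qed
    moreover have "finite T"
      using finV unfolding T_def Z_def cn_insert by (rule rev_finite_subset) auto
    ultimately show ?thesis using L(2) by (metis card_image card_mono)
  qed
  moreover have "card T + card (?cn S - (B \<union> N) - \<Union>K') \<le> card (?cn (insert v S) - B - \<Union>K)"
  proof (rule card_add_le)
    show "finite (?cn (insert v S) - B - \<Union>K)" using finV by simp
    have "\<Union>(M - L) \<subseteq> N" using MN by auto
    then show "T \<union> (?cn S - (B \<union> N) - \<Union>K') \<subseteq> ?cn (insert v S) - B - \<Union>K"
      unfolding T_def Z_def K_def cn_insert by auto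
    show "T \<inter> (?cn S - (B \<union> N) - \<Union>K') = {}" unfolding T_def Z_def by auto
  qed
  ultimately have "k * card (insert v S) \<le> card (?cn (insert v S) - B - \<Union>K)"
    using K'(4) insert.hyps by simp
  moreover have "reaches E k (B \<union> \<Union>K) (B \<union> ?cn (insert v S))"
  proof -
    have "neighbors E v - (B \<union> \<Union>K) \<subseteq> \<Union>L"
    proof
      fix x assume x: "x \<in> neighbors E v - (B \<union> \<Union>K)"
      then have "x \<in> Z" unfolding Z_def N_def K_def by auto
      then have "x \<in> \<Union>M" using M(2) by auto
      then show "x \<in> \<Union>L" using x unfolding K_def by auto
    qed
    moreover have "L \<subseteq> E" "\<forall>e\<in>L. v \<in> e" using L(1) ME Mv by auto
    ultimately have "star_coverable E k v (neighbors E v - (B \<union> \<Union>K))"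
      unfolding star_coverable_def using L(2) finL by (intro exI[of _ L]) simp
    then have "reaches E k (B \<union> \<Union>K) ((B \<union> \<Union>K) \<union> neighbors E v)"
      using vK by (intro reaches_neighbors) auto
    moreover have "(B \<union> N) \<union> \<Union>K' \<subseteq> (B \<union> \<Union>K) \<union> neighbors E v"
      using vK unfolding N_def K_def by auto
    ultimately have "reaches E k (B \<union> \<Union>K) ((B \<union> N) \<union> \<Union>K')"
      by (meson reaches_subset reaches_trans)
    then show ?thesis using K'(5) reaches_trans unfolding cn_insert by (metis Un_assoc)
  qed
  moreover have "K \<subseteq> E" unfolding K_def using K'(1) ME by auto
  moreover have "insert v S \<subseteq> \<Union>K" using vK K'(2) unfolding K_def by auto
  moreover have "\<Union>K \<subseteq> ?cn (insert v S)" using K'(3) MN unfolding K_def cn_insert by auto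
  ultimately show ?case by (intro exI[of _ K]) simp
qed

lemma neighbor_in_closed_neighborhood:
  "x \<in> S \<Longrightarrow> w \<in> neighbors E x \<Longrightarrow> w \<in> closed_neighborhood E S"
  unfolding closed_neighborhood_def by auto

text \<open>Take the distance to \<open>B\<close>: the next vertex on a shortest path is
  closer.\<close>

lemma distance_potential:
  assumes "hconnected V E" "b \<in> V" "b \<in> B"
  shows "\<exists>g::'a \<Rightarrow> nat. \<forall>v\<in>V. v \<in> B \<or> (\<exists>u. adjacent E v u \<and> g u < g v)"
proof -
  define g where "g v = (LEAST n. \<exists>b\<in>B. (adjacent E ^^ n) v b)" for v
  have "v \<in> B \<or> (\<exists>u. adjacent E v u \<and> g u < g v)" if "v \<in> V" for v
  proof -
    have "(adjacent E)\<^sup>*\<^sup>* v b" using assms that unfolding hconnected_def by simp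
    then obtain n where "(adjacent E ^^ n) v b" by (metis rtranclp_power)
    then have "\<exists>n. \<exists>b\<in>B. (adjacent E ^^ n) v b" using assms(3) by auto
    then have "\<exists>b\<in>B. (adjacent E ^^ g v) v b" unfolding g_def by (rule LeastI_ex)
    then obtain c where c: "c \<in> B" "(adjacent E ^^ g v) v c" by auto
    show ?thesis
    proof (cases "g v")
      case 0
      then show ?thesis using c by simp
    next
      case (Suc m)
      then obtain u where u: "adjacent E v u" "(adjacent E ^^ m) u c"
        using c(2) relpowp_Suc_D2 by metis
      have "g u \<le> m" unfolding g_def using u(2) c(1) by (intro Least_le) auto
      then show ?thesis using u Suc by auto
    qed
  qed
  then show ?thesis by auto
qed

text \<open>Among the minimum sets, minimize first the number of members not adjacent to another member and
  then the total distance to the vertices whose closed neighborhood is not coverable. Otherwise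
  moving an offending vertex to a suitable neighbor yields a better set.\<close>

lemma minimum_power_dominating_set:
  fixes V :: "'a set" and E k
  defines "\<gamma> \<equiv> power_domination_number V E k"
  assumes H: "hypergraph V E" and conn: "hconnected V E"
    and big: "b \<in> V" "\<not> star_coverable E k b (insert b (neighbors E b))"
  obtains D where "power_dominating V E k D" "card D = \<gamma>"
    "\<And>v. v \<in> D \<Longrightarrow>
      \<not> star_coverable E k v (insert v (neighbors E v) - closed_neighborhood E (D - {v}))"
proof -
  let ?cn = "closed_neighborhood E"
  define Big where "Big = {v. \<not> star_coverable E k v (insert v (neighbors E v))}"
  obtain g :: "'a \<Rightarrow> nat" where g: "\<And>v. v \<in> V \<Longrightarrow> v \<in> Big \<or> (\<exists>u. adjacent E v u \<and> g u < g v)"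
    using distance_potential[OF conn big(1), of Big] big(2) unfolding Big_def by auto
  define Q where "Q D \<longleftrightarrow> power_dominating V E k D \<and> card D = \<gamma>" for D
  define I where "I D = {v\<in>D. v \<notin> ?cn (D - {v})}" for D
  have \<gamma>_le: "\<gamma> \<le> card D" if "power_dominating V E k D" for D
    unfolding \<gamma>_def power_domination_number_def using that by (intro Least_le) auto
  have "\<exists>m. \<exists>D. power_dominating V E k D \<and> card D = m"
    using power_dominating_vertices[OF H] by auto
  then have "\<exists>D. Q D"
    unfolding Q_def \<gamma>_def power_domination_number_def by (rule LeastI_ex)
  then obtain D0 where "Q D0" by auto
  from ex_has_least_nat[of Q, OF this, of "\<lambda>D. card (I D)"] obtain D1
    where D1: "Q D1" "\<And>D'. Q D' \<Longrightarrow> card (I D1) \<le> card (I D')" by auto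
  have "Q D1 \<and> card (I D1) = card (I D1)" using D1 by simp
  from ex_has_least_nat[of "\<lambda>D. Q D \<and> card (I D) = card (I D1)", OF this, of "sum g"] obtain D
    where D: "Q D" "card (I D) = card (I D1)"
      and Dsum: "\<And>D'. Q D' \<Longrightarrow> card (I D') = card (I D1) \<Longrightarrow> sum g D \<le> sum g D'" by auto
  have PD: "power_dominating V E k D" and cardD: "card D = \<gamma>" using D(1) unfolding Q_def by auto
  have DV: "D \<subseteq> V" using PD unfolding power_dominating_def by simp
  have finV: "finite V" using H unfolding hypergraph_def by simp
  have finD: "finite D" using DV finV by (rule finite_subset)
  have nbV: "u \<in> V" if "adjacent E v u" for u v
    using that H unfolding hypergraph_def adjacent_def by auto
  have "\<not> star_coverable E k v (insert v (neighbors E v) - ?cn (D - {v}))" if v: "v \<in> D" for v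
  proof
    assume cov: "star_coverable E k v (insert v (neighbors E v) - ?cn (D - {v}))"
    \<comment> \<open>Otherwise \<open>v\<close> would be redundant by the exchange lemma, against
      minimality.\<close>
    have vcn: "v \<notin> ?cn (D - {v})"
    proof
      assume "v \<in> ?cn (D - {v})"
      then have "power_dominating V E k (D - {v})"
        using DV cov by (intro power_dominating_exchange[OF H PD v]) auto
      then have "\<gamma> \<le> card (D - {v})" by (rule \<gamma>_le)
      then show False using card_Diff1_less[OF finD v] cardD by simp
    qed
    then have vI: "v \<in> I D" using v unfolding I_def by simp
    have finI: "finite (I D)" using finD unfolding I_def by simp
    \<comment> \<open>The swap isolates no old member: \<open>v\<close> has no neighbor in
      \<open>D\<close>, so a member adjacent to another one keeps that neighbor.\<close>
    have swap: "Q (insert u (D - {v})) \<and> I (insert u (D - {v})) \<subseteq> insert u (I D - {v}) \<and> u \<notin> D"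
      if u: "adjacent E v u" for u
    proof -
      let ?D = "insert u (D - {v})"
      have vu: "v \<in> neighbors E u" using adjacent_sym[OF u] unfolding neighbors_def by simp
      have "u \<noteq> v" using u unfolding adjacent_def by auto
      have uD: "u \<notin> D"
      proof
        assume "u \<in> D"
        then have "v \<in> ?cn (D - {v})"
          using vu \<open>u \<noteq> v\<close> unfolding closed_neighborhood_def by auto
        then show False using vcn by simp
      qed
      have "v \<in> ?cn ?D" using vu unfolding closed_neighborhood_def by simp
      then have "power_dominating V E k ?D"
        using DV nbV[OF u] cov by (intro power_dominating_exchange[OF H PD v]) auto
      moreover have "card ?D = card D"
        unfolding card.remove[OF finD v] using finD uD by (intro card_insert_disjoint) auto
      moreover have "I ?D \<subseteq> insert u (I D - {v})"
      proof
        fix w assume w: "w \<in> I ?D"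
        show "w \<in> insert u (I D - {v})"
        proof (cases "w = u")
          case False
          then have wD: "w \<in> D" "w \<noteq> v" and wn: "w \<notin> ?cn (?D - {w})"
            using w unfolding I_def by auto
          have "w \<notin> ?cn (D - {w})"
          proof
            assume "w \<in> ?cn (D - {w})"
            then obtain x where x: "x \<in> D" "x \<noteq> w" "w \<in> insert x (neighbors E x)"
              unfolding closed_neighborhood_def by auto
            then have wx: "w \<in> neighbors E x" by auto
            have "x \<noteq> v"
            proof
              assume "x = v"
              then have "v \<in> neighbors E w"
                using adjacent_sym[of E v w] wx unfolding neighbors_def by simp
              then show False using vcn wD neighbor_in_closed_neighborhood[of w "D - {v}" v E] by simp
            qed
            then have "x \<in> ?D - {w}" using x by auto
            then show False using wn neighbor_in_closed_neighborhood[OF _ wx] by metis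
          qed
          then show ?thesis using wD unfolding I_def by simp
        qed simp
      qed
      ultimately show ?thesis using cardD uD unfolding Q_def by simp
    qed
    have Imin: "card (I D) \<le> card (I D')" if "Q D'" for D' using D1(2)[OF that] D(2) by simp
    \<comment> \<open>If another member dominated \<open>u\<close>, the swap would remove
      \<open>v\<close> from \<open>I D\<close> without adding \<open>u\<close>. Hence the whole
      closed neighborhood of \<open>v\<close> is private, \<open>v\<close> is outside
      \<open>Big\<close>, and a swap towards \<open>Big\<close> lowers the distance sum.\<close>
    have "u \<notin> ?cn (D - {v})" if u: "adjacent E v u" for u
    proof
      assume ucn: "u \<in> ?cn (D - {v})"
      let ?D = "insert u (D - {v})"
      have "?D - {u} = D - {v}" using swap[OF u] by auto
      then have "u \<notin> I ?D" using ucn unfolding I_def by simp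
      then have "I ?D \<subseteq> I D - {v}" using swap[OF u] by auto
      then have "card (I ?D) \<le> card (I D - {v})" using finI by (intro card_mono) auto
      also have "\<dots> < card (I D)" using finI vI by (rule card_Diff1_less)
      finally show False using Imin[of ?D] swap[OF u] by simp
    qed
    then have "insert v (neighbors E v) - ?cn (D - {v}) = insert v (neighbors E v)"
      using vcn unfolding neighbors_def by auto
    then have "v \<notin> Big" using cov unfolding Big_def by simp
    then obtain u where u: "adjacent E v u" "g u < g v" using g v DV by auto
    let ?D = "insert u (D - {v})"
    have "card (I ?D) \<le> card (insert u (I D - {v}))"
      using finI swap[OF u(1)] by (intro card_mono) auto
    also have "\<dots> \<le> Suc (card (I D - {v}))" using finI by (simp add: card_insert_if)
    also have "\<dots> = card (I D)" using finI vI by (rule card.remove[symmetric])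
    finally have "card (I ?D) = card (I D1)" using Imin[of ?D] swap[OF u(1)] D(2) by simp
    then have "sum g D \<le> sum g ?D" using Dsum swap[OF u(1)] by simp
    moreover have "sum g ?D = g u + sum g (D - {v})"
      using finD swap[OF u(1)] by (intro sum.insert) auto
    moreover have "sum g D = g v + sum g (D - {v})" using finD v by (rule sum.remove)
    ultimately show False using u(2) by simp
  qed
  then show thesis using that[of D] PD cardD by simp
qed

text \<open>Every blue vertex can force all its neighbors, so blue spreads from \<open>v\<close>
  along paths.\<close>

lemma power_dominating_singleton:
  assumes H: "hypergraph V E" and conn: "hconnected V E" and v: "v \<in> V"
    and small: "\<And>u. u \<in> V \<Longrightarrow> star_coverable E k u (insert u (neighbors E u))"
  shows "power_dominating V E k {v}"
proof -
  let ?B = "closed_neighborhood E {v}"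
  have nbV: "u \<in> V" if "adjacent E w u" for u w
    using that H unfolding hypergraph_def adjacent_def by auto
  have one: "reaches E k ?B {u}" if "u \<in> V" for u
  proof -
    have "(adjacent E)\<^sup>*\<^sup>* v u" using conn v that unfolding hconnected_def by simp
    then have "u \<in> V \<and> reaches E k ?B {u}"
    proof (induction rule: rtranclp_induct)
      case base
      show ?case using v by (simp add: reaches_subset closed_neighborhood_def)
    next
      case (step y z)
      then have "star_coverable E k y (neighbors E y - {y})"
        using star_coverable_subset[OF small[of y]] by auto
      then have "reaches E k {y} ({y} \<union> neighbors E y)" by (intro reaches_neighbors) auto
      moreover have "{z} \<subseteq> {y} \<union> neighbors E y" using step.hyps(2) unfolding neighbors_def by simp
      ultimately have "reaches E k {y} {z}" by (meson reaches_subset reaches_trans)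
      then show ?case using step.IH reaches_trans nbV[OF step.hyps(2)] by metis
    qed
    then show ?thesis by simp
  qed
  have "reaches E k ?B W" if "finite W" "W \<subseteq> V" for W
    using that
  proof (induction W rule: finite_induct)
    case empty
    then show ?case by (simp add: reaches_subset)
  next
    case (insert x W)
    then have "reaches E k ?B ({x} \<union> W)" using one by (intro reaches_Un) auto
    then show ?case by simp
  qed
  then have "reaches E k ?B V" using H unfolding hypergraph_def by simp
  then show ?thesis using v unfolding power_dominating_iff_reaches[OF H] by simp
qed

theorem corollary3p8:
  fixes V :: "'a set" and E :: "'a set set" and r k :: nat
  assumes "r \<in> {3, 4}"
    and "hypergraph V E"
    and "uniform r E"
    and "hconnected V E"
    and "\<forall>v\<in>V. \<not> isolated E v"
    and "k + r \<le> card V"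
  shows "real (power_domination_number V E k) \<le> real (card V) / real (r + k)"
proof -
  let ?\<gamma> = "power_domination_number V E k"
  let ?cn = "closed_neighborhood E"
  note H = assms(2)
  have finV: "finite V" using H unfolding hypergraph_def by simp
  have finE: "finite E" using H unfolding hypergraph_def by (meson finite_Pow_iff finite_subset)
  have le: "?\<gamma> \<le> card D" if "power_dominating V E k D" for D
    unfolding power_domination_number_def using that by (intro Least_le) auto
  have "(r + k) * ?\<gamma> \<le> card V"
  proof (cases "\<exists>b\<in>V. \<not> star_coverable E k b (insert b (neighbors E b))")
    \<comment> \<open>One vertex suffices here, and the claim becomes the hypothesis
      \<open>k + r \<le> card V\<close>.\<close>
    case False
    have "V \<noteq> {}" using assms(1,6) by auto
    then obtain v where "v \<in> V" by auto
    then have "power_dominating V E k {v}"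
      using False by (intro power_dominating_singleton[OF H assms(4)]) auto
    then have "?\<gamma> \<le> 1" using le by fastforce
    then have "(r + k) * ?\<gamma> \<le> (r + k) * 1" by (rule mult_le_mono2)
    also have "\<dots> \<le> card V" using assms(6) by simp
    finally show ?thesis .
  next
    case True
    then obtain b where b: "b \<in> V" "\<not> star_coverable E k b (insert b (neighbors E b))" by auto
    obtain D where D: "power_dominating V E k D" "card D = ?\<gamma>"
      and priv: "\<And>v. v \<in> D \<Longrightarrow>
        \<not> star_coverable E k v (insert v (neighbors E v) - ?cn (D - {v}))"
      using minimum_power_dominating_set[OF H assms(4) b] by metis
    have DV: "D \<subseteq> V" and DR: "reaches E k (?cn D) V"
      using D(1) unfolding power_dominating_iff_reaches[OF H] by auto
    have finD: "finite D" using DV finV by (rule finite_subset)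
    have "star E v \<noteq> {}" if "v \<in> D" for v
    proof -
      have "\<not> isolated E v" using assms(5) DV that by auto
      then show ?thesis unfolding isolated_def adjacent_def star_def by auto
    qed
    \<comment> \<open>No vertex has forced yet, so the set \<open>B\<close> of the edge selection is
      empty.\<close>
    moreover have "\<not> star_coverable E k v (insert v (neighbors E v) - ?cn (D - {v}) - {})"
      if "v \<in> D" for v using priv[OF that] by simp
    ultimately obtain K where K: "K \<subseteq> E" "\<Union>K \<subseteq> ?cn D"
      and white: "k * card D \<le> card (?cn D - {} - \<Union>K)"
      and reach: "reaches E k ({} \<union> \<Union>K) ({} \<union> ?cn D)"
      using forcing_edge_set[OF H finD DV] by metis
    have finK: "finite K" using K(1) finE by (rule finite_subset)
    have "card e = r" if "e \<in> K" for e using that K(1) assms(3) unfolding uniform_def by auto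
    then obtain T where T: "T \<subseteq> \<Union>K" "\<And>x. x \<in> \<Union>K \<Longrightarrow> \<exists>e\<in>K. x \<in> e \<and> T \<inter> e \<noteq> {}"
      and rT: "r * card T \<le> card (\<Union>K)"
      using dominating_3_4_uniform[OF assms(1) finK] by metis
    have cnV: "?cn D \<subseteq> V" using H DV by (rule closed_neighborhood_subset_vertices)
    have "\<Union>K \<subseteq> ?cn T"
    proof
      fix x assume "x \<in> \<Union>K"
      then obtain e t where "e \<in> K" "x \<in> e" "t \<in> T" "t \<in> e" using T(2) by (metis disjoint_iff)
      then show "x \<in> ?cn T" using edge_subset_closed_neighborhood[of e E t T] K(1) by auto
    qed
    then have "reaches E k (?cn T) (\<Union>K)" by (rule reaches_subset)
    then have "reaches E k (?cn T) V" using reach DR reaches_trans by (metis Un_empty_left)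
    moreover have "T \<subseteq> V" using T(1) K(2) cnV by auto
    ultimately have "power_dominating V E k T" unfolding power_dominating_iff_reaches[OF H] by simp
    then have "?\<gamma> \<le> card T" by (rule le)
    then have "r * ?\<gamma> \<le> r * card T" by (rule mult_le_mono2)
    moreover have "card (?cn D - {} - \<Union>K) + card (\<Union>K) \<le> card V"
      using cnV K(2) finV by (intro card_add_le) auto
    moreover have "k * ?\<gamma> \<le> card (?cn D - {} - \<Union>K)" using white D(2) by simp
    ultimately show ?thesis using rT unfolding distrib_right by linarith
  qed
  then have "real (r + k) * real ?\<gamma> \<le> real (card V)" by (metis of_nat_le_iff of_nat_mult)
  moreover have "0 < real (r + k)" using assms(1) by auto
  ultimately show ?thesis by (simp add: pos_le_divide_eq mult.commute)
qed

end
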